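(* Let $M$ be a positive integer and let $X_i,Y_i\in\mathbb{R}$ for $i=1,\ldots,M$, with $X_i\ne 0$ for at least one $i$. Consider the problem $$\min_{\theta\in\mathbb{R}}\ \max_{1\le i\le M}|X_i\theta-Y_i|.$$ The minimum value of the objective function in this problem is equal to $$\mu=\max_{\substack{1\le i<k\le M\\ |X_i|+|X_k|\ne 0}}\frac{|Y_iX_k-Y_kX_i|}{|X_i|+|X_k|},$$ and all solutions of the problem are given by the condition $$\max_{\substack{1\le i\le M\\ X_i\ne 0}}\left(-\frac{\mu}{|X_i|}+\frac{Y_i}{X_i}\right)\le\theta\le\min_{\substack{1\le i\le M\\ X_i\ne 0}}\left(\frac{\mu}{|X_i|}+\frac{Y_i}{X_i}\right);$$ that is, $\theta\in\mathbb{R}$ is a minimizer if and only if it satisfies this double inequality.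
   Context: The maximum defining $\mu$ over an empty set of index pairs (which occurs only for $M=1$) is taken to be $0$. *)

theory Defs
  imports Complex_Main
begin

definition objective :: "nat \<Rightarrow> (nat \<Rightarrow> real) \<Rightarrow> (nat \<Rightarrow> real) \<Rightarrow> real \<Rightarrow> real" where
  "objective M X Y \<theta> = (MAX i\<in>{1..M}. \<bar>X i * \<theta> - Y i\<bar>)"

definition admissible_pairs :: "nat \<Rightarrow> (nat \<Rightarrow> real) \<Rightarrow> (nat \<times> nat) set" where
  "admissible_pairs M X =
     {(i, k). 1 \<le> i \<and> i < k \<and> k \<le> M \<and> \<bar>X i\<bar> + \<bar>X k\<bar> \<noteq> 0}"

(* Max of the empty set is unspecified, so the convention that the empty maximum
   is 0 is built in explicitly. *)
definition mu :: "nat \<Rightarrow> (nat \<Rightarrow> real) \<Rightarrow> (nat \<Rightarrow> real) \<Rightarrow> real" where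
  "mu M X Y =
     (if admissible_pairs M X = {} then 0
      else MAX (i, k)\<in>admissible_pairs M X.
             \<bar>Y i * X k - Y k * X i\<bar> / (\<bar>X i\<bar> + \<bar>X k\<bar>))"

end

(* The condition objective <= mu says that theta lies in every interval
   [(Y i - mu) / X i, (Y i + mu) / X i] (endpoints swapped if X i < 0) with X i nonzero.
   The definition of mu says exactly that these intervals meet pairwise, and that
   |Y k| <= mu whenever X k = 0; intervals of the line that meet pairwise have a common
   point (the one-dimensional Helly theorem), so the value mu is attained. Conversely,
   eliminating theta from two residuals gives
     Y i * X k - Y k * X i = X i * (X k * theta - Y k) - X k * (X i * theta - Y i),
   which bounds every term of mu by the objective at theta. *)
theory Submission
  imports Defs
begin

lemma objective_le_iff:
  assumes "M \<ge> 1"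
  shows "objective M X Y \<theta> \<le> c \<longleftrightarrow> (\<forall>i\<in>{1..M}. \<bar>X i * \<theta> - Y i\<bar> \<le> c)"
  using assms by (simp add: objective_def)

lemma finite_admissible_pairs: "finite (admissible_pairs M X)"
  by (rule finite_subset[of _ "{1..M} \<times> {1..M}"]) (auto simp: admissible_pairs_def)

text \<open>Without admissible pairs the right side is vacuous and \<open>mu\<close> is 0 by
  convention, hence the hypothesis on \<open>c\<close>.\<close>

lemma mu_le_iff:
  assumes "0 \<le> c"
  shows "mu M X Y \<le> c \<longleftrightarrow>
    (\<forall>(i, k)\<in>admissible_pairs M X. \<bar>Y i * X k - Y k * X i\<bar> / (\<bar>X i\<bar> + \<bar>X k\<bar>) \<le> c)"
  using assms by (auto simp: mu_def finite_admissible_pairs)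

lemma mu_nonneg: "0 \<le> mu M X Y"
proof (cases "admissible_pairs M X = {}")
  case False
  then obtain i k where "(i, k) \<in> admissible_pairs M X" by auto
  then show ?thesis
    by (auto simp: mu_def finite_admissible_pairs Max_ge_iff intro!: bexI[of _ "(i, k)"])
qed (simp add: mu_def)

lemma mu_le_objective:
  assumes "M \<ge> 1"
  shows "mu M X Y \<le> objective M X Y \<theta>"
proof -
  let ?o = "objective M X Y \<theta>"
  have res: "\<bar>X i * \<theta> - Y i\<bar> \<le> ?o" if "i \<in> {1..M}" for i
    using objective_le_iff[OF assms] that by blast
  have "0 \<le> ?o" using res[of 1] assms by auto
  moreover have "\<bar>Y i * X k - Y k * X i\<bar> / (\<bar>X i\<bar> + \<bar>X k\<bar>) \<le> ?o"
    if "(i, k) \<in> admissible_pairs M X" for i k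
  proof -
    from that have ik: "i \<in> {1..M}" "k \<in> {1..M}" and pos: "0 < \<bar>X i\<bar> + \<bar>X k\<bar>"
      by (auto simp: admissible_pairs_def)
    have "\<bar>Y i * X k - Y k * X i\<bar> = \<bar>X i * (X k * \<theta> - Y k) - X k * (X i * \<theta> - Y i)\<bar>"
      by (simp add: algebra_simps)
    also have "\<dots> \<le> \<bar>X i\<bar> * \<bar>X k * \<theta> - Y k\<bar> + \<bar>X k\<bar> * \<bar>X i * \<theta> - Y i\<bar>"
      by (metis abs_mult abs_triangle_ineq4)
    also have "\<dots> \<le> \<bar>X i\<bar> * ?o + \<bar>X k\<bar> * ?o"
      by (intro add_mono mult_left_mono res ik) auto
    finally show ?thesis
      using pos by (simp add: divide_le_eq algebra_simps)
  qed
  ultimately show ?thesis by (auto simp: mu_le_iff)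
qed

text \<open>Clearing the denominator extends the bound to all pairs of indices: it is symmetric in
  \<open>i\<close> and \<open>k\<close>, and its left side vanishes when \<open>i = k\<close> or
  when both coefficients are 0.\<close>

lemma pair_le_mu:
  assumes "i \<in> {1..M}" "k \<in> {1..M}"
  shows "\<bar>Y i * X k - Y k * X i\<bar> \<le> mu M X Y * (\<bar>X i\<bar> + \<bar>X k\<bar>)"
proof -
  have ordered: "\<bar>Y i * X k - Y k * X i\<bar> \<le> mu M X Y * (\<bar>X i\<bar> + \<bar>X k\<bar>)"
    if "i < k" "i \<in> {1..M}" "k \<in> {1..M}" for i k
  proof (cases "\<bar>X i\<bar> + \<bar>X k\<bar> = 0")
    case False
    then have "(i, k) \<in> admissible_pairs M X"
      using that by (auto simp: admissible_pairs_def)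
    \<comment> \<open>Taking \<open>c\<close> to be \<open>mu M X Y\<close> itself in
      \<open>mu_le_iff\<close> bounds each single term.\<close>
    then have "\<bar>Y i * X k - Y k * X i\<bar> / (\<bar>X i\<bar> + \<bar>X k\<bar>) \<le> mu M X Y"
      using mu_le_iff[OF mu_nonneg, of M X Y M X Y] by auto
    with False show ?thesis by (simp add: divide_le_eq split: if_splits)
  next
    case True
    then have "X i = 0" "X k = 0" by linarith+
    then show ?thesis by simp
  qed
  consider "i < k" | "k < i" | "i = k" by linarith
  then show ?thesis
  proof cases
    case 2
    then show ?thesis using ordered[of k i] assms by (simp add: abs_minus_commute add.commute)
  qed (use ordered assms mu_nonneg in auto)
qed

text \<open>Dividing by \<open>\<bar>x\<bar>\<close> instead of \<open>x\<close> gives an interval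
  with centre \<open>y / x\<close> and radius \<open>c / \<bar>x\<bar>\<close>, with no case split
  on the sign of \<open>x\<close>.\<close>

lemma abs_residual_le_iff:
  fixes x y \<theta> c :: real
  assumes "x \<noteq> 0"
  shows "\<bar>x * \<theta> - y\<bar> \<le> c \<longleftrightarrow> - (c / \<bar>x\<bar>) + y / x \<le> \<theta> \<and> \<theta> \<le> c / \<bar>x\<bar> + y / x"
proof -
  have "\<bar>x * \<theta> - y\<bar> = \<bar>x\<bar> * \<bar>\<theta> - y / x\<bar>"
    using assms by (simp flip: abs_mult add: right_diff_distrib)
  then have "\<bar>x * \<theta> - y\<bar> \<le> c \<longleftrightarrow> \<bar>\<theta> - y / x\<bar> \<le> c / \<bar>x\<bar>"
    using assms by (simp add: pos_le_divide_eq mult.commute)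
  then show ?thesis by auto
qed

text \<open>Dividing \<open>pair_le_mu\<close> by \<open>\<bar>X i\<bar> * \<bar>X k\<bar>\<close>
  shows that the distance between the two centres is at most the sum of the radii.\<close>

lemma intervals_meet:
  assumes "i \<in> {1..M}" "k \<in> {1..M}" "X i \<noteq> 0" "X k \<noteq> 0"
  shows "- (mu M X Y / \<bar>X i\<bar>) + Y i / X i \<le> mu M X Y / \<bar>X k\<bar> + Y k / X k"
proof -
  have "\<bar>Y i / X i - Y k / X k\<bar> = \<bar>Y i * X k - Y k * X i\<bar> / (\<bar>X i\<bar> * \<bar>X k\<bar>)"
    using assms by (simp add: diff_frac_eq abs_mult)
  also have "\<dots> \<le> mu M X Y * (\<bar>X i\<bar> + \<bar>X k\<bar>) / (\<bar>X i\<bar> * \<bar>X k\<bar>)"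
    by (intro divide_right_mono pair_le_mu assms) auto
  also have "\<dots> = mu M X Y / \<bar>X i\<bar> + mu M X Y / \<bar>X k\<bar>"
    using assms by (simp add: field_simps)
  finally show ?thesis by linarith
qed

text \<open>Pairing \<open>k\<close> with an index \<open>i\<close> where \<open>X i\<close> is
  nonzero, the factor \<open>\<bar>X i\<bar>\<close> cancels from \<open>pair_le_mu\<close>.\<close>

lemma abs_le_mu_if_zero:
  assumes "k \<in> {1..M}" "X k = 0" "\<exists>i\<in>{1..M}. X i \<noteq> 0"
  shows "\<bar>Y k\<bar> \<le> mu M X Y"
proof -
  obtain i where i: "i \<in> {1..M}" "X i \<noteq> 0" using assms by blast
  then have "\<bar>Y k\<bar> * \<bar>X i\<bar> \<le> mu M X Y * \<bar>X i\<bar>"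
    using pair_le_mu[of k M i Y X] assms by (simp add: abs_mult)
  then show ?thesis using i by simp
qed

theorem proposition2:
  fixes M :: nat and X Y :: "nat \<Rightarrow> real"
  assumes "M \<ge> 1"
    and "\<exists>i\<in>{1..M}. X i \<noteq> 0"
  shows "((\<exists>\<theta>. objective M X Y \<theta> = mu M X Y) \<and> (\<forall>\<theta>. mu M X Y \<le> objective M X Y \<theta>)) \<and>
    (\<forall>\<theta>. is_arg_min (objective M X Y) (\<lambda>_. True) \<theta> \<longleftrightarrow>
      (MAX i\<in>{i\<in>{1..M}. X i \<noteq> 0}. - (mu M X Y / \<bar>X i\<bar>) + Y i / X i) \<le> \<theta> \<and>
      \<theta> \<le> (MIN i\<in>{i\<in>{1..M}. X i \<noteq> 0}. mu M X Y / \<bar>X i\<bar> + Y i / X i))"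
proof -
  let ?I = "{i\<in>{1..M}. X i \<noteq> 0}"
  let ?lo = "MAX i\<in>?I. - (mu M X Y / \<bar>X i\<bar>) + Y i / X i"
  let ?hi = "MIN i\<in>?I. mu M X Y / \<bar>X i\<bar> + Y i / X i"
  have I: "finite ?I" "?I \<noteq> {}" using assms(2) by auto
  note lower = mu_le_objective[OF assms(1), of X Y]
  have between_iff: "objective M X Y \<theta> \<le> mu M X Y \<longleftrightarrow> ?lo \<le> \<theta> \<and> \<theta> \<le> ?hi" for \<theta>
  proof -
    \<comment> \<open>Where \<open>X i = 0\<close> the residual is \<open>\<bar>Y i\<bar>\<close>,
      at most \<open>mu\<close> for every \<open>\<theta>\<close>, so only the indices in
      \<open>?I\<close> constrain \<open>\<theta>\<close>.\<close>
    have "objective M X Y \<theta> \<le> mu M X Y \<longleftrightarrow> (\<forall>i\<in>?I. \<bar>X i * \<theta> - Y i\<bar> \<le> mu M X Y)"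
      unfolding objective_le_iff[OF assms(1)] using abs_le_mu_if_zero[OF _ _ assms(2)] by force
    also have "\<dots> \<longleftrightarrow> ?lo \<le> \<theta> \<and> \<theta> \<le> ?hi"
      using I by (auto simp: abs_residual_le_iff)
    finally show ?thesis .
  qed
  \<comment> \<open>Helly on the line: if every left endpoint is at most every right endpoint, then
    the largest left one is at most the smallest right one.\<close>
  have "?lo \<le> ?hi"
  proof (intro Max.boundedI Min.boundedI)
    fix a b
    assume "a \<in> (\<lambda>i. - (mu M X Y / \<bar>X i\<bar>) + Y i / X i) ` ?I"
      and "b \<in> (\<lambda>i. mu M X Y / \<bar>X i\<bar> + Y i / X i) ` ?I"
    then show "a \<le> b" by clarify (rule intervals_meet)
  qed (use I in simp_all)
  then have attained: "objective M X Y ?lo = mu M X Y"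
    using between_iff[of ?lo] lower[of ?lo] by auto
  \<comment> \<open>As \<open>mu\<close> is a lower bound attained at \<open>?lo\<close>, minimizers
    are exactly the points with value at most \<open>mu\<close>.\<close>
  have "is_arg_min (objective M X Y) (\<lambda>_. True) \<theta> \<longleftrightarrow> objective M X Y \<theta> \<le> mu M X Y" for \<theta>
  proof
    assume "is_arg_min (objective M X Y) (\<lambda>_. True) \<theta>"
    then have "objective M X Y \<theta> \<le> objective M X Y ?lo"
      unfolding is_arg_min_linorder by blast
    then show "objective M X Y \<theta> \<le> mu M X Y" unfolding attained .
  next
    assume "objective M X Y \<theta> \<le> mu M X Y"
    then show "is_arg_min (objective M X Y) (\<lambda>_. True) \<theta>"
      unfolding is_arg_min_linorder using order_trans[OF _ lower] by blast
  qed
  then have "\<forall>\<theta>. is_arg_min (objective M X Y) (\<lambda>_. True) \<theta> \<longleftrightarrow> ?lo \<le> \<theta> \<and> \<theta> \<le> ?hi"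
    unfolding between_iff by (rule allI)
  with exI[of "\<lambda>\<theta>. objective M X Y \<theta> = mu M X Y", OF attained] allI[OF lower]
  show ?thesis by (intro conjI)
qed

end
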